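(* Let $|N|\ge 2$, $x\in N$, $M:=N\setminus x$ and $r\in\mathbb{R}^{\mathcal{P}(M)}$. Let $m=T_{u\text{-mod}}(r)\in\mathbb{R}^{\mathcal{P}(N)}$ be the upper modular extension of $r$. (i) One has $m\in\mathcal{K}(N)$ if and only if $r\in\mathcal{K}(M)$. The independency model induced by $m$ is then determined as follows: given $\langle a,b|C\rangle\in\mathcal{E}(N)$, one has $a\perp b\mid C\ [m]$ if and only if one of the following holds: - $x\in C$; - $x\in\{a,b\}$ and $r_u((a\cup b\cup C)\setminus x)=r_u(C)$; - $x\notin a\cup b\cup C$ and $a\perp b\mid C\ [r]$. (ii) The function $r$ is extreme in $\mathcal{K}(M)$ if and only if $m=T_{u\text{-mod}}(r)$ is extreme in $\mathcal{K}(N)$.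
   Context: $N$ is a finite set and $\mathcal{P}(N)$ is its power set; a singleton $\{a\}$ is written $a$. $\mathbb{R}^{\mathcal{P}(N)}$ is the space of functions $m:\mathcal{P}(N)\to\mathbb{R}$ with scalar product $\langle m,u\rangle=\sum_{A\subseteq N}m(A)u(A)$. A function $m$ is supermodular if $m(A)+m(B)\le m(A\cup B)+m(A\cap B)$ for all $A,B\subseteq N$; $\mathcal{K}(N)$ is the cone of supermodular functions. $\mathcal{E}(N)$ is the set of triplets $\langle a,b|C\rangle$ with $a,b\in N$ distinct and $C\subseteq N\setminus\{a,b\}$. For $m\in\mathbb{R}^{\mathcal{P}(N)}$, $a\perp b\mid C\ [m]$ means $m(a\cup b\cup C)+m(C)-m(a\cup C)-m(b\cup C)=0$; the independency model induced by $m\in\mathcal{K}(N)$ is the set of $\langle a,b|C\rangle\in\mathcal{E}(N)$ with $a\perp b\mid C\ [m]$. A face of a convex cone $K\subseteq\mathbb{R}^{\mathcal{P}(N)}$ is a set $\{m\in K: k=\langle m,v\rangle\}$, where $v\in\mathbb{R}^{\mathcal{P}(N)}$, $k\in\mathbb{R}$ satisfy $k\le\langle m,v\rangle$ for all $m\in K$. The non-empty faces of $\mathcal{K}(N)$ form a lattice under inclusion with least element the space of modular functions $\mathcal{K}(N)\cap(-\mathcal{K}(N))$. A function is extreme in $\mathcal{K}(N)$ if it belongs to $\mathcal{K}(N)$ and the smallest face of $\mathcal{K}(N)$ containing it is an atom of this lattice. The same definitions are used for other finite sets in place of $N$. For $r\in\mathbb{R}^{\mathcal{P}(M)}$ the upper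 standardization is $r_u(T)=r(T)+(|M|-1)\,r(M)-\sum_{j\in M}r(M\setminus j)+\sum_{i\in T}[r(M\setminus i)-r(M)]$ for $T\subseteq M$. For $\emptyset\ne M\subsetneq N$ the upper modular extension $T_{u\text{-mod}}:\mathbb{R}^{\mathcal{P}(M)}\to\mathbb{R}^{\mathcal{P}(N)}$ is defined, for $S\subseteq N$, by $[T_{u\text{-mod}}(r)](S)=r(S)$ if $S\subseteq M$, and $[T_{u\text{-mod}}(r)](S)=r(S\cap M)-r_u(S\cap M)$ otherwise. *)

theory Defs
  imports Complex_Main "HOL-Library.FuncSet"
begin

text \<open>
  The space of real functions on the power set of \<open>N\<close> consists of functions that are extensional
  on \<^term>\<open>Pow N\<close>, i.e. equal to \<^term>\<open>undefined\<close> outside it; so equality of functions (and hence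
  of sets of functions) is equality on \<^term>\<open>Pow N\<close>.
\<close>

definition setfuns :: "'a set \<Rightarrow> ('a set \<Rightarrow> real) set" where
  "setfuns N = Pow N \<rightarrow>\<^sub>E UNIV"

definition scalar_prod :: "'a set \<Rightarrow> ('a set \<Rightarrow> real) \<Rightarrow> ('a set \<Rightarrow> real) \<Rightarrow> real" where
  "scalar_prod N m u = (\<Sum>A\<in>Pow N. m A * u A)"

definition supermodular_cone :: "'a set \<Rightarrow> ('a set \<Rightarrow> real) set" where
  "supermodular_cone N =
     {m \<in> setfuns N. \<forall>A B. A \<subseteq> N \<longrightarrow> B \<subseteq> N \<longrightarrow> m A + m B \<le> m (A \<union> B) + m (A \<inter> B)}"

definition triplets :: "'a set \<Rightarrow> ('a \<times> 'a \<times> 'a set) set" where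
  "triplets N = {(a, b, C). a \<in> N \<and> b \<in> N \<and> a \<noteq> b \<and> C \<subseteq> N - {a, b}}"

definition cond_indep :: "('a set \<Rightarrow> real) \<Rightarrow> 'a \<Rightarrow> 'a \<Rightarrow> 'a set \<Rightarrow> bool" where
  "cond_indep m a b C \<longleftrightarrow>
     m ({a} \<union> {b} \<union> C) + m C - m ({a} \<union> C) - m ({b} \<union> C) = 0"

definition faces :: "'a set \<Rightarrow> ('a set \<Rightarrow> real) set \<Rightarrow> ('a set \<Rightarrow> real) set set" where
  "faces N K =
     {F. \<exists>v\<in>setfuns N. \<exists>k. (\<forall>m\<in>K. k \<le> scalar_prod N m v) \<and> F = {m \<in> K. k = scalar_prod N m v}}"

definition nonempty_faces :: "'a set \<Rightarrow> ('a set \<Rightarrow> real) set \<Rightarrow> ('a set \<Rightarrow> real) set set" where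
  "nonempty_faces N K = {F \<in> faces N K. F \<noteq> {}}"

definition least_in :: "'b set set \<Rightarrow> 'b set \<Rightarrow> bool" where
  "least_in \<L> F \<longleftrightarrow> F \<in> \<L> \<and> (\<forall>G\<in>\<L>. F \<subseteq> G)"

definition atom_in :: "'b set set \<Rightarrow> 'b set \<Rightarrow> bool" where
  "atom_in \<L> F \<longleftrightarrow>
     F \<in> \<L> \<and> (\<exists>Z. least_in \<L> Z \<and> Z \<subset> F \<and> \<not> (\<exists>G\<in>\<L>. Z \<subset> G \<and> G \<subset> F))"

definition extreme_supermodular :: "'a set \<Rightarrow> ('a set \<Rightarrow> real) \<Rightarrow> bool" where
  "extreme_supermodular N m \<longleftrightarrow>
     m \<in> supermodular_cone N \<and>
     (\<exists>F. least_in {G \<in> faces N (supermodular_cone N). m \<in> G} F \<and>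
          atom_in (nonempty_faces N (supermodular_cone N)) F)"

definition upper_std :: "'a set \<Rightarrow> ('a set \<Rightarrow> real) \<Rightarrow> 'a set \<Rightarrow> real" where
  "upper_std M r =
     (\<lambda>T\<in>Pow M. r T + (real (card M) - 1) * r M - (\<Sum>j\<in>M. r (M - {j}))
                 + (\<Sum>i\<in>T. r (M - {i}) - r M))"

definition upper_mod_ext :: "'a set \<Rightarrow> 'a set \<Rightarrow> ('a set \<Rightarrow> real) \<Rightarrow> 'a set \<Rightarrow> real" where
  "upper_mod_ext N M r =
     (\<lambda>S\<in>Pow N. if S \<subseteq> M then r S else r (S \<inter> M) - upper_std M r (S \<inter> M))"

end

theory Submission
  imports Defs
begin

text \<open>
  The cone of supermodular functions is cut out by the elementary inequalities
  \<open>m(abC) + m(C) - m(aC) - m(bC) \<ge> 0\<close>. Hence the smallest face containing \<open>m\<close> consists of the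
  supermodular \<open>u\<close> satisfying all conditional independences of \<open>m\<close>, and extremality of \<open>m\<close> only
  depends on the inclusions between the independency models of supermodular functions.
  For functions \<open>u\<close> on the power set of \<open>N\<close> satisfying \<open>a \<perp> b | C\<close> whenever \<open>x \<in> C\<close>, and
  \<open>x \<perp> a | M - a\<close> for all \<open>a\<close>, the imbalance at \<open>\<langle>x,a|C\<rangle>\<close> is the sum of the imbalances
  at \<open>\<langle>a,e|D\<rangle>\<close> along any chain of sets from \<open>C\<close> to \<open>M - a\<close>. So supermodularity of \<open>u\<close> and its
  independency model are controlled by its restriction to \<open>M\<close>. The upper modular extension is of
  this kind, and so is every \<open>u\<close> whose independency model contains that of such an extension.
\<close>

section \<open>Elementary imbalances\<close>

text \<open>The mixed second difference of \<open>m\<close> at \<open>C\<close> in the directions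
  \<open>a\<close> and \<open>b\<close>. Its value is kept, and not only its vanishing, so that
  signs and telescoping sums can be used.\<close>

definition imbalance :: "('a set \<Rightarrow> real) \<Rightarrow> 'a \<Rightarrow> 'a \<Rightarrow> 'a set \<Rightarrow> real" where
  "imbalance m a b C = m (insert a (insert b C)) + m C - m (insert a C) - m (insert b C)"

lemma cond_indep_iff: "cond_indep m a b C \<longleftrightarrow> imbalance m a b C = 0"
  by (simp add: cond_indep_def imbalance_def insert_commute)

lemma imbalance_commute: "imbalance m a b C = imbalance m b a C"
  by (simp add: imbalance_def insert_commute)

lemma mem_triplets_iff:
  "(a, b, C) \<in> triplets N \<longleftrightarrow> a \<in> N \<and> b \<in> N \<and> a \<noteq> b \<and> C \<subseteq> N - {a, b}"
  by (simp add: triplets_def)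

lemma imbalance_cong:
  assumes "\<And>A. A \<subseteq> M \<Longrightarrow> m A = u A" "(a, b, C) \<in> triplets M"
  shows "imbalance m a b C = imbalance u a b C"
proof -
  have "insert a (insert b C) \<subseteq> M" "insert a C \<subseteq> M" "insert b C \<subseteq> M" "C \<subseteq> M"
    using assms(2) by (auto simp: mem_triplets_iff)
  then show ?thesis
    by (simp add: imbalance_def assms(1))
qed

lemma finite_triplets:
  assumes "finite N"
  shows "finite (triplets N)"
proof (rule finite_subset)
  show "triplets N \<subseteq> N \<times> N \<times> Pow N"
    by (auto simp: triplets_def)
qed (simp add: assms)

text \<open>Local inequalities suffice: the gain from adding one element grows as the base set grows
  element by element, and adding the elements of \<open>A - B\<close> in turn to
  \<open>A \<inter> B\<close> and to \<open>B\<close> then compares the two total gains.\<close>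

lemma supermodular_cone_iff_imbalance:
  assumes "finite N"
  shows "m \<in> supermodular_cone N \<longleftrightarrow>
    m \<in> setfuns N \<and> (\<forall>(a, b, C) \<in> triplets N. 0 \<le> imbalance m a b C)"
proof (intro iffI conjI)
  assume m: "m \<in> supermodular_cone N"
  then show "m \<in> setfuns N"
    by (simp add: supermodular_cone_def)
  show "\<forall>(a, b, C) \<in> triplets N. 0 \<le> imbalance m a b C"
  proof clarify
    fix a b C assume t: "(a, b, C) \<in> triplets N"
    then have *: "insert a C \<subseteq> N" "insert b C \<subseteq> N" "insert a C \<union> insert b C = insert a (insert b C)"
      "insert a C \<inter> insert b C = C"
      by (auto simp: mem_triplets_iff)
    have "m (insert a C) + m (insert b C) \<le> m (insert a C \<union> insert b C) + m (insert a C \<inter> insert b C)"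
      using m *(1,2) unfolding supermodular_cone_def by blast
    then show "0 \<le> imbalance m a b C"
      unfolding *(3,4) by (simp add: imbalance_def)
  qed
next
  assume "m \<in> setfuns N \<and> (\<forall>(a, b, C) \<in> triplets N. 0 \<le> imbalance m a b C)"
  then have m: "m \<in> setfuns N"
    and nn: "\<And>a b C. (a, b, C) \<in> triplets N \<Longrightarrow> 0 \<le> imbalance m a b C"
    by auto
  \<comment> \<open>Enlarges the base set while the added element \<open>a\<close> is fixed.\<close>
  have incr: "m (insert a C) - m C \<le> m (insert a (C \<union> E)) - m (C \<union> E)"
    if "finite E" "a \<in> N" "C \<union> E \<subseteq> N - {a}" for a C E
    using that
  proof (induction E)
    case (insert e E)
    show ?case
    proof (cases "e \<in> C")
      case True
      then have "C \<union> insert e E = C \<union> E" by auto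
      then show ?thesis using insert by simp
    next
      case False
      then have "(a, e, C \<union> E) \<in> triplets N"
        using insert by (auto simp: mem_triplets_iff)
      from nn[OF this] insert show ?thesis
        by (simp add: imbalance_def)
    qed
  qed simp
  \<comment> \<open>Now the base sets \<open>C\<close> and \<open>B\<close> are fixed and the
    elements of \<open>D\<close> are added one at a time, summing the previous inequality.\<close>
  have diff: "m (C \<union> D) - m C \<le> m (B \<union> D) - m B"
    if "finite D" "C \<subseteq> B" "B \<subseteq> N" "D \<subseteq> N - B" for B C D
    using that
  proof (induction D)
    case (insert d D)
    have "finite B" using insert.prems(2) assms by (rule finite_subset)
    moreover have "C \<union> D \<union> (B - C) = B \<union> D" using insert.prems by auto
    ultimately have "m (insert d (C \<union> D)) - m (C \<union> D) \<le> m (insert d (B \<union> D)) - m (B \<union> D)"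
      using incr[of "B - C" d "C \<union> D"] insert by auto
    then show ?case using insert by simp
  qed simp
  have "m A + m B \<le> m (A \<union> B) + m (A \<inter> B)" if "A \<subseteq> N" "B \<subseteq> N" for A B
  proof -
    have "finite (A - B)" using that assms by (meson finite_Diff finite_subset)
    then have "m (A \<inter> B \<union> (A - B)) - m (A \<inter> B) \<le> m (B \<union> (A - B)) - m B"
      using diff[of "A - B" "A \<inter> B" B] that by blast
    moreover have "A \<inter> B \<union> (A - B) = A" "B \<union> (A - B) = A \<union> B" by auto
    ultimately show ?thesis by simp
  qed
  then show "m \<in> supermodular_cone N"
    using m by (simp add: supermodular_cone_def)
qed

lemma imbalance_nonneg:
  "finite N \<Longrightarrow> m \<in> supermodular_cone N \<Longrightarrow> (a, b, C) \<in> triplets N \<Longrightarrow> 0 \<le> imbalance m a b C"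
  by (auto simp: supermodular_cone_iff_imbalance)

section \<open>Faces and independency models\<close>

definition indep_model :: "'a set \<Rightarrow> ('a set \<Rightarrow> real) \<Rightarrow> ('a \<times> 'a \<times> 'a set) set" where
  "indep_model N m = {(a, b, C) \<in> triplets N. cond_indep m a b C}"

lemma mem_indep_model_iff:
  "(a, b, C) \<in> indep_model N m \<longleftrightarrow> (a, b, C) \<in> triplets N \<and> imbalance m a b C = 0"
  by (simp add: indep_model_def cond_indep_iff)

lemma indep_model_subset_triplets: "indep_model N m \<subseteq> triplets N"
  by (auto simp: indep_model_def)

lemma indep_model_cong:
  assumes "\<And>A. A \<subseteq> M \<Longrightarrow> m A = u A"
  shows "indep_model M m = indep_model M u"
  using imbalance_cong[of M m u] assms by (auto simp: mem_indep_model_iff)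

text \<open>A combinatorial description of the smallest face containing a supermodular
  \<open>m\<close>; the agreement is \<open>least_face_containing_iff\<close>.\<close>

definition minimal_face :: "'a set \<Rightarrow> ('a set \<Rightarrow> real) \<Rightarrow> ('a set \<Rightarrow> real) set" where
  "minimal_face N m = {u \<in> supermodular_cone N. indep_model N m \<subseteq> indep_model N u}"

text \<open>A face needs a normal vector in \<open>setfuns N\<close>. This predicate lets such a
  vector be assembled from evaluations by linear combinations, without an explicit formula.\<close>

definition scalar_prod_form :: "'a set \<Rightarrow> (('a set \<Rightarrow> real) \<Rightarrow> real) \<Rightarrow> bool" where
  "scalar_prod_form N \<phi> \<longleftrightarrow> (\<exists>v \<in> setfuns N. \<forall>m. scalar_prod N m v = \<phi> m)"

lemma scalar_prod_formI:
  assumes "\<And>m. scalar_prod N m (\<lambda>A\<in>Pow N. v A) = \<phi> m"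
  shows "scalar_prod_form N \<phi>"
  unfolding scalar_prod_form_def
  by (rule bexI[of _ "\<lambda>A\<in>Pow N. v A"]) (auto simp: assms setfuns_def)

lemma scalar_prod_form_eval:
  assumes "finite N" "A \<subseteq> N"
  shows "scalar_prod_form N (\<lambda>m. m A)"
proof -
  have "scalar_prod N m (\<lambda>B\<in>Pow N. if B = A then 1 else 0) = m A" for m
  proof -
    have "scalar_prod N m (\<lambda>B\<in>Pow N. if B = A then 1 else 0) =
        (\<Sum>B\<in>Pow N. if B = A then m B else 0)"
      unfolding scalar_prod_def by (rule sum.cong) auto
    then show ?thesis
      using assms by simp
  qed
  then show ?thesis
    by (rule scalar_prod_formI)
qed

lemma scalar_prod_form_lincomb:
  assumes "scalar_prod_form N \<phi>" "scalar_prod_form N \<psi>"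
  shows "scalar_prod_form N (\<lambda>m. \<phi> m + c * \<psi> m)"
proof -
  obtain v w where v: "\<And>m. scalar_prod N m v = \<phi> m" and w: "\<And>m. scalar_prod N m w = \<psi> m"
    using assms by (auto simp: scalar_prod_form_def)
  have "scalar_prod N m (\<lambda>B\<in>Pow N. v B + c * w B) = \<phi> m + c * \<psi> m" for m
    unfolding v[symmetric] w[symmetric]
    by (simp add: scalar_prod_def algebra_simps sum.distrib sum_distrib_left)
  then show ?thesis
    by (rule scalar_prod_formI)
qed

lemma scalar_prod_form_zero: "scalar_prod_form N (\<lambda>m. 0)"
  unfolding scalar_prod_form_def
  by (rule bexI[of _ "\<lambda>B\<in>Pow N. 0"]) (auto simp: scalar_prod_def setfuns_def)

lemma scalar_prod_form_imbalance:
  assumes "finite N" "(a, b, C) \<in> triplets N"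
  shows "scalar_prod_form N (\<lambda>m. imbalance m a b C)"
proof -
  have "insert a (insert b C) \<subseteq> N" "insert a C \<subseteq> N" "insert b C \<subseteq> N" "C \<subseteq> N"
    using assms(2) by (auto simp: mem_triplets_iff)
  note eval = this[THEN scalar_prod_form_eval[OF assms(1)]]
  show ?thesis
    using scalar_prod_form_lincomb[OF scalar_prod_form_lincomb
        [OF scalar_prod_form_lincomb[OF eval(1) eval(4), of 1] eval(2), of "-1"] eval(3), of "-1"]
    by (simp add: imbalance_def algebra_simps)
qed

lemma scalar_prod_form_sum:
  assumes "finite I" "\<And>i. i \<in> I \<Longrightarrow> scalar_prod_form N (\<lambda>m. \<phi> i m)"
  shows "scalar_prod_form N (\<lambda>m. \<Sum>i\<in>I. \<phi> i m)"
  using assms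
proof (induction I)
  case (insert i I)
  then show ?case
    using scalar_prod_form_lincomb[of N "\<phi> i" "\<lambda>m. \<Sum>i\<in>I. \<phi> i m" 1] by simp
qed (simp add: scalar_prod_form_zero)

text \<open>The supporting functional is the sum of the imbalances over the model of
  \<open>m\<close>: on the cone all terms are nonnegative, so the sum is 0 exactly when each term
  is.\<close>

lemma minimal_face_mem_faces:
  assumes fin: "finite N"
  shows "minimal_face N m \<in> faces N (supermodular_cone N)"
proof -
  let ?I = "indep_model N m"
  let ?\<phi> = "\<lambda>u. \<Sum>(a, b, C) \<in> ?I. imbalance u a b C"
  have sub: "?I \<subseteq> triplets N"
    by (rule indep_model_subset_triplets)
  have finI: "finite ?I"
    using sub finite_triplets[OF fin] by (rule finite_subset)
  have "scalar_prod_form N ?\<phi>"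
    using finI sub scalar_prod_form_imbalance[OF fin] by (intro scalar_prod_form_sum) auto
  then obtain v where v: "v \<in> setfuns N" "\<And>u. scalar_prod N u v = ?\<phi> u"
    by (auto simp: scalar_prod_form_def)
  have nn: "\<forall>i\<in>?I. 0 \<le> (case i of (a, b, C) \<Rightarrow> imbalance u a b C)"
    if "u \<in> supermodular_cone N" for u
    using that sub imbalance_nonneg[OF fin] by fastforce
  have "?\<phi> u = 0 \<longleftrightarrow> ?I \<subseteq> indep_model N u" if "u \<in> supermodular_cone N" for u
    using sum_nonneg_eq_0_iff[of ?I "\<lambda>(a, b, C). imbalance u a b C"] finI nn[OF that] sub
    by (fastforce simp: mem_indep_model_iff)
  then have "minimal_face N m = {u \<in> supermodular_cone N. 0 = scalar_prod N u v}"
    unfolding minimal_face_def v(2) by auto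
  moreover have "\<forall>u \<in> supermodular_cone N. 0 \<le> scalar_prod N u v"
    unfolding v(2) using nn by (blast intro: sum_nonneg)
  ultimately show ?thesis
    unfolding faces_def using v(1) by blast
qed

text \<open>
  If \<open>u\<close> satisfies all independences of \<open>m\<close>, then the segment from \<open>u\<close> to \<open>m\<close> can be prolonged
  a little beyond \<open>m\<close> inside the cone, so no supporting hyperplane through \<open>m\<close> misses \<open>u\<close>.
\<close>
lemma minimal_face_subset:
  assumes fin: "finite N" and m: "m \<in> supermodular_cone N"
    and G: "G \<in> faces N (supermodular_cone N)" "m \<in> G"
  shows "minimal_face N m \<subseteq> G"
proof
  fix u assume "u \<in> minimal_face N m"
  then have u: "u \<in> supermodular_cone N" and sub: "indep_model N m \<subseteq> indep_model N u"
    by (auto simp: minimal_face_def)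
  obtain v k where k: "\<And>w. w \<in> supermodular_cone N \<Longrightarrow> k \<le> scalar_prod N w v"
    and Gdef: "G = {w \<in> supermodular_cone N. k = scalar_prod N w v}"
    using G(1) by (auto simp: faces_def)
  let ?q = "\<lambda>(a, b, C). imbalance u a b C / imbalance m a b C"
  \<comment> \<open>A common upper bound for all ratios of imbalances of \<open>u\<close> and
    \<open>m\<close>. Triplets with zero denominator contribute 0, since division by 0 gives 0; the
    summand 1 keeps \<open>c\<close> positive.\<close>
  define c where "c = 1 + (\<Sum>t\<in>triplets N. \<bar>?q t\<bar>)"
  have c: "c \<ge> 1"
    by (simp add: c_def sum_nonneg)
  define \<epsilon> where "\<epsilon> = 1 / c"
  have \<epsilon>: "\<epsilon> > 0"
    using c by (simp add: \<epsilon>_def)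
  define w where "w = (\<lambda>A\<in>Pow N. (1 + \<epsilon>) * m A - \<epsilon> * u A)"
  have "0 \<le> imbalance w a b C" if t: "(a, b, C) \<in> triplets N" for a b C
  proof -
    let ?p = "imbalance m a b C"
    have "imbalance w a b C = imbalance (\<lambda>A. (1 + \<epsilon>) * m A - \<epsilon> * u A) a b C"
      using t by (intro imbalance_cong[of N]) (auto simp: w_def)
    also have "\<dots> = (1 + \<epsilon>) * ?p - \<epsilon> * imbalance u a b C"
      by (simp add: imbalance_def algebra_simps)
    also have "\<dots> \<ge> 0"
    proof (cases "?p = 0")
      case True
      then have "imbalance u a b C = 0"
        using t sub mem_indep_model_iff[of a b C N] by blast
      then show ?thesis using True by simp
    next
      case False
      then have p: "?p > 0"
        using imbalance_nonneg[OF fin m t] by simp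
      have "?q (a, b, C) \<le> \<bar>?q (a, b, C)\<bar>" by (rule abs_ge_self)
      also have "\<dots> \<le> (\<Sum>t\<in>triplets N. \<bar>?q t\<bar>)"
        using t finite_triplets[OF fin] by (intro member_le_sum) auto
      also have "\<dots> \<le> c" by (simp add: c_def)
      finally have "imbalance u a b C \<le> c * ?p"
        using p by (simp add: pos_divide_le_eq)
      then have "\<epsilon> * imbalance u a b C \<le> \<epsilon> * (c * ?p)"
        using \<epsilon> by (intro mult_left_mono) auto
      also have "\<dots> = ?p" using c by (simp add: \<epsilon>_def)
      also have "\<dots> \<le> (1 + \<epsilon>) * ?p"
        using p \<epsilon> by (simp add: algebra_simps)
      finally show ?thesis by simp
    qed
    finally show ?thesis .
  qed
  then have "w \<in> supermodular_cone N"
    using fin by (auto simp: supermodular_cone_iff_imbalance w_def setfuns_def)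
  then have "k \<le> scalar_prod N w v" by (rule k)
  also have "\<dots> = (1 + \<epsilon>) * scalar_prod N m v - \<epsilon> * scalar_prod N u v"
    by (simp add: w_def scalar_prod_def algebra_simps sum.distrib sum_subtractf sum_distrib_left)
  also have "scalar_prod N m v = k"
    using G(2) by (simp add: Gdef)
  finally have "\<epsilon> * scalar_prod N u v \<le> \<epsilon> * k"
    by (simp add: algebra_simps)
  then have "scalar_prod N u v \<le> k"
    using \<epsilon> by simp
  then show "u \<in> G"
    using k[OF u] u by (simp add: Gdef)
qed

lemma mem_minimal_face: "m \<in> supermodular_cone N \<Longrightarrow> m \<in> minimal_face N m"
  by (simp add: minimal_face_def)

section \<open>Least faces, modular functions and extremality\<close>

lemma least_face_containing_iff:
  assumes "finite N" "m \<in> supermodular_cone N"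
  shows "least_in {G \<in> faces N (supermodular_cone N). m \<in> G} F \<longleftrightarrow> F = minimal_face N m"
  using minimal_face_mem_faces[OF assms(1), of m] minimal_face_subset[OF assms]
    mem_minimal_face[OF assms(2)]
  unfolding least_in_def by blast

definition modular_functions :: "'a set \<Rightarrow> ('a set \<Rightarrow> real) set" where
  "modular_functions N = {u \<in> supermodular_cone N. triplets N \<subseteq> indep_model N u}"

lemma zero_function:
  assumes "finite N"
  shows "(\<lambda>A\<in>Pow N. 0) \<in> supermodular_cone N" "indep_model N (\<lambda>A\<in>Pow N. 0) = triplets N"
proof -
  have "imbalance (\<lambda>A\<in>Pow N. 0) a b C = 0" if "(a, b, C) \<in> triplets N" for a b C
    using imbalance_cong[of N "\<lambda>A\<in>Pow N. 0" "\<lambda>_. 0", OF _ that] by (simp add: imbalance_def)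
  then show "(\<lambda>A\<in>Pow N. 0) \<in> supermodular_cone N" "indep_model N (\<lambda>A\<in>Pow N. 0) = triplets N"
    using assms by (auto simp: supermodular_cone_iff_imbalance setfuns_def mem_indep_model_iff)
qed

text \<open>The modular functions form the minimal face of the zero function, and any non-empty face
  contains the minimal face of each of its members, hence all modular functions.\<close>

lemma least_nonempty_face_iff:
  assumes fin: "finite N"
  shows "least_in (nonempty_faces N (supermodular_cone N)) Z \<longleftrightarrow> Z = modular_functions N"
proof -
  have "modular_functions N = minimal_face N (\<lambda>A\<in>Pow N. 0)"
    by (simp add: modular_functions_def minimal_face_def zero_function[OF fin])
  then have "modular_functions N \<in> nonempty_faces N (supermodular_cone N)"
    using minimal_face_mem_faces[OF fin] mem_minimal_face[OF zero_function(1)[OF fin]]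
    unfolding nonempty_faces_def by auto
  moreover have "modular_functions N \<subseteq> G" if G: "G \<in> nonempty_faces N (supermodular_cone N)" for G
  proof -
    obtain u where "u \<in> G" "G \<in> faces N (supermodular_cone N)"
      using G by (auto simp: nonempty_faces_def)
    moreover from this have "u \<in> supermodular_cone N"
      by (auto simp: faces_def)
    ultimately have "minimal_face N u \<subseteq> G"
      by (intro minimal_face_subset[OF fin])
    moreover have "modular_functions N \<subseteq> minimal_face N u"
      using indep_model_subset_triplets[of N u]
      unfolding modular_functions_def minimal_face_def by blast
    ultimately show ?thesis by simp
  qed
  ultimately show ?thesis
    unfolding least_in_def by blast
qed

text \<open>Minimal faces are ordered by reverse inclusion of models, and a face strictly between
  the modular functions and the face of \<open>m\<close> can be replaced by the minimal face of one
  of its non-modular members. So being an atom means that the model is maximal among those different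
  from \<open>triplets N\<close>.\<close>

lemma extreme_supermodular_iff:
  assumes fin: "finite N"
  shows "extreme_supermodular N m \<longleftrightarrow>
    m \<in> supermodular_cone N \<and> \<not> triplets N \<subseteq> indep_model N m \<and>
    (\<forall>u \<in> supermodular_cone N. indep_model N m \<subseteq> indep_model N u \<longrightarrow>
       \<not> triplets N \<subseteq> indep_model N u \<longrightarrow> indep_model N u \<subseteq> indep_model N m)"
proof (cases "m \<in> supermodular_cone N")
  case m: True
  let ?K = "supermodular_cone N" and ?Z = "modular_functions N" and ?F = "minimal_face N"
  have face: "?F u \<in> nonempty_faces N ?K" if "u \<in> ?K" for u
    using minimal_face_mem_faces[OF fin] mem_minimal_face[OF that]
    unfolding nonempty_faces_def by auto
  have ZF: "?Z \<subseteq> ?F u" for u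
    using indep_model_subset_triplets[of N u]
    unfolding modular_functions_def minimal_face_def by blast
  have Z_iff: "?Z \<subset> ?F u \<longleftrightarrow> \<not> triplets N \<subseteq> indep_model N u" if "u \<in> ?K" for u
    using mem_minimal_face[OF that] ZF[of u] that
    unfolding modular_functions_def minimal_face_def by blast
  have F_iff: "?F u \<subset> ?F m \<longleftrightarrow> indep_model N m \<subset> indep_model N u" if "u \<in> ?K" for u
    using that m unfolding minimal_face_def by blast
  have "extreme_supermodular N m \<longleftrightarrow>
      ?Z \<subset> ?F m \<and> \<not> (\<exists>G \<in> nonempty_faces N ?K. ?Z \<subset> G \<and> G \<subset> ?F m)"
    using m face[OF m]
    by (simp add: extreme_supermodular_def least_face_containing_iff[OF fin m] atom_in_def
        least_nonempty_face_iff[OF fin])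
  also have "(\<exists>G \<in> nonempty_faces N ?K. ?Z \<subset> G \<and> G \<subset> ?F m) \<longleftrightarrow>
      (\<exists>u \<in> ?K. ?Z \<subset> ?F u \<and> ?F u \<subset> ?F m)"
  proof
    assume "\<exists>G \<in> nonempty_faces N ?K. ?Z \<subset> G \<and> G \<subset> ?F m"
    then obtain G where G: "G \<in> faces N ?K" "?Z \<subset> G" "G \<subset> ?F m"
      by (auto simp: nonempty_faces_def)
    then obtain u where u: "u \<in> G" "u \<notin> ?Z" by blast
    have K: "u \<in> ?K" using u(1) G(1) by (auto simp: faces_def)
    have "?F u \<subset> ?F m"
      using minimal_face_subset[OF fin K G(1) u(1)] G(3) by blast
    moreover have "?Z \<subset> ?F u"
      using ZF[of u] mem_minimal_face[OF K] u(2) by blast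
    ultimately show "\<exists>u \<in> ?K. ?Z \<subset> ?F u \<and> ?F u \<subset> ?F m"
      using K by blast
  qed (use face in blast)
  also have "\<dots> \<longleftrightarrow> (\<exists>u \<in> ?K. \<not> triplets N \<subseteq> indep_model N u \<and> indep_model N m \<subset> indep_model N u)"
    by (intro bex_cong) (simp_all add: Z_iff F_iff)
  finally show ?thesis
    unfolding Z_iff[OF m] using m by (simp add: less_le_not_le) blast
qed (simp add: extreme_supermodular_def)

section \<open>Upper modular functions\<close>

text \<open>Only vanishing imbalances are demanded, so the property passes to functions with a
  larger model. The second conjunct concerns the largest conditioning sets, where the descending
  induction below starts.\<close>

definition upper_modular :: "'a set \<Rightarrow> 'a \<Rightarrow> ('a set \<Rightarrow> real) \<Rightarrow> bool" where
  "upper_modular N x u \<longleftrightarrow>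
     (\<forall>(a, b, C) \<in> triplets N. x \<in> C \<longrightarrow> imbalance u a b C = 0) \<and>
     (\<forall>a \<in> N - {x}. imbalance u x a (N - {x} - {a}) = 0)"

text \<open>Needed for arbitrary members of the minimal face of an extension, which need not be
  extensions themselves.\<close>

lemma upper_modular_mono:
  assumes "upper_modular N x m" "indep_model N m \<subseteq> indep_model N u" "x \<in> N"
  shows "upper_modular N x u"
proof -
  have "imbalance u a b C = 0"
    if "(a, b, C) \<in> triplets N" "imbalance m a b C = 0" for a b C
    using assms(2) that mem_indep_model_iff[of a b C N] by blast
  moreover have "(x, a, N - {x} - {a}) \<in> triplets N" if "a \<in> N - {x}" for a
    using assms(3) that by (auto simp: mem_triplets_iff)
  ultimately show ?thesis
    using assms(1) unfolding upper_modular_def by fastforce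
qed

text \<open>Both sides are chain-rule expansions of the imbalance between \<open>{a}\<close> and
  \<open>{x, b}\<close> given \<open>C\<close>.\<close>

lemma imbalance_exchange:
  "imbalance u x a (insert b C) + imbalance u a b C =
   imbalance u a b (insert x C) + imbalance u x a C"
  by (simp add: imbalance_def insert_commute)

lemma upper_modular_imbalance_step:
  assumes "upper_modular N x u" "x \<in> N" "(a, b, C) \<in> triplets (N - {x})"
  shows "imbalance u x a C = imbalance u x a (insert b C) + imbalance u a b C"
proof -
  have "(a, b, insert x C) \<in> triplets N"
    using assms(2,3) by (auto simp: mem_triplets_iff)
  then have "imbalance u a b (insert x C) = 0"
    using assms(1) unfolding upper_modular_def by blast
  then show ?thesis
    using imbalance_exchange[of u x a b C] by simp
qed

text \<open>Descending induction on the conditioning set, run as ordinary finite induction on the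
  set \<open>E\<close> removed from \<open>N - {x} - {a}\<close>.\<close>

lemma upper_modular_induct [consumes 4, case_names top step]:
  assumes "finite N" "x \<in> N" "a \<in> N - {x}" "C \<subseteq> N - {x} - {a}"
    and top: "P (N - {x} - {a})"
    and step: "\<And>e C. (a, e, C) \<in> triplets (N - {x}) \<Longrightarrow> P (insert e C) \<Longrightarrow> P C"
  shows "P C"
proof -
  have "P (N - {x} - {a} - E)" if "finite E" "E \<subseteq> N - {x} - {a}" for E
    using that
  proof (induction E)
    case (insert e E)
    let ?C = "N - {x} - {a} - insert e E"
    have "(a, e, ?C) \<in> triplets (N - {x})" "insert e ?C = N - {x} - {a} - E"
      using insert assms(3) by (auto simp: mem_triplets_iff)
    then show ?case using step[of e ?C] insert by simp
  qed (simp add: top)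
  from this[of "N - {x} - {a} - C"] show ?thesis
    using assms(1,4) by (simp add: double_diff)
qed

lemma upper_modular_imbalance_nonneg:
  assumes "finite N" "x \<in> N" "upper_modular N x u" "a \<in> N - {x}" "C \<subseteq> N - {x} - {a}"
    and "\<And>a b C. (a, b, C) \<in> triplets (N - {x}) \<Longrightarrow> 0 \<le> imbalance u a b C"
  shows "0 \<le> imbalance u x a C"
  using assms(1,2,4,5)
proof (induction rule: upper_modular_induct)
  case top
  then show ?case using assms(3,4) by (auto simp: upper_modular_def)
next
  case (step e C)
  then show ?case
    using upper_modular_imbalance_step[OF assms(3,2)] assms(6) by fastforce
qed

section \<open>Reduction from \<open>N\<close> to \<open>N - {x}\<close>\<close>

lemma triplets_cases [consumes 1, case_names cond fst snd del]:
  assumes "(a, b, C) \<in> triplets N"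
  obtains "x \<in> C" | "a = x" "b \<in> N - {x}" "C \<subseteq> N - {x} - {b}"
    | "b = x" "a \<in> N - {x}" "C \<subseteq> N - {x} - {a}"
    | "x \<notin> insert a (insert b C)" "(a, b, C) \<in> triplets (N - {x})"
  using assms by (auto simp: mem_triplets_iff)

lemma triplets_mono: "M \<subseteq> N \<Longrightarrow> triplets M \<subseteq> triplets N"
  by (auto simp: triplets_def)

text \<open>Imbalances with \<open>x\<close> in the conditioning set vanish, and those with
  \<open>x\<close> as an end point are sums of imbalances within \<open>N - {x}\<close>. A separate
  \<open>s\<close> stands for the restriction because members of \<open>setfuns (N - {x})\<close>
  are extensional on a smaller power set.\<close>

lemma upper_modular_supermodular_iff:
  assumes fin: "finite N" and x: "x \<in> N" and u: "upper_modular N x u" "u \<in> setfuns N"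
    and s: "s \<in> setfuns (N - {x})" "\<And>A. A \<subseteq> N - {x} \<Longrightarrow> s A = u A"
  shows "u \<in> supermodular_cone N \<longleftrightarrow> s \<in> supermodular_cone (N - {x})"
proof
  assume u_in: "u \<in> supermodular_cone N"
  have "s A + s B \<le> s (A \<union> B) + s (A \<inter> B)" if A: "A \<subseteq> N - {x}" "B \<subseteq> N - {x}" for A B
  proof -
    have "A \<union> B \<subseteq> N - {x}" "A \<inter> B \<subseteq> N - {x}" "A \<subseteq> N" "B \<subseteq> N"
      using A by auto
    moreover from this(3,4) have "u A + u B \<le> u (A \<union> B) + u (A \<inter> B)"
      using u_in unfolding supermodular_cone_def by blast
    ultimately show ?thesis
      using A s(2) by simp
  qed
  then show "s \<in> supermodular_cone (N - {x})"
    using s(1) by (simp add: supermodular_cone_def)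
next
  assume s_in: "s \<in> supermodular_cone (N - {x})"
  have nn: "0 \<le> imbalance u a b C" if "(a, b, C) \<in> triplets (N - {x})" for a b C
    using imbalance_nonneg[OF _ s_in that] imbalance_cong[of "N - {x}" s u, OF s(2) that] fin by simp
  have "0 \<le> imbalance u a b C" if "(a, b, C) \<in> triplets N" for a b C
    using that
  proof (cases rule: triplets_cases[where x = x])
    case cond
    then show ?thesis using u(1) that unfolding upper_modular_def by fastforce
  next
    case fst
    then show ?thesis using upper_modular_imbalance_nonneg[OF fin x u(1) _ _ nn] by simp
  next
    case snd
    then show ?thesis
      using upper_modular_imbalance_nonneg[OF fin x u(1) _ _ nn] imbalance_commute[of u a b C] by simp
  qed (rule nn)
  then show "u \<in> supermodular_cone N"
    using u(2) fin by (auto simp: supermodular_cone_iff_imbalance)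
qed

text \<open>For \<open>u\<close> a zero sum of nonnegative imbalances forces every summand to be
  zero. The summands within \<open>N - {x}\<close> then vanish for \<open>v\<close> too, and so does
  their sum.\<close>

lemma upper_modular_indep_transfer:
  assumes fin: "finite N" and x: "x \<in> N" and a: "a \<in> N - {x}" and C: "C \<subseteq> N - {x} - {a}"
    and u: "upper_modular N x u" "u \<in> supermodular_cone N" and v: "upper_modular N x v"
    and sub: "indep_model (N - {x}) u \<subseteq> indep_model (N - {x}) v"
    and zero: "imbalance u x a C = 0"
  shows "imbalance v x a C = 0"
  using fin x a C zero
proof (induction rule: upper_modular_induct)
  case top
  then show ?case using v a by (auto simp: upper_modular_def)
next
  case (step e C)
  have t: "(a, e, C) \<in> triplets N" "(x, a, insert e C) \<in> triplets N"
    using step.hyps x by (auto simp: mem_triplets_iff)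
  have "imbalance u x a (insert e C) + imbalance u a e C = 0"
    using upper_modular_imbalance_step[OF u(1) x step.hyps] step.prems by simp
  then have "imbalance u x a (insert e C) = 0" "imbalance u a e C = 0"
    using t[THEN imbalance_nonneg[OF fin u(2)]] by auto
  then have "imbalance v x a (insert e C) = 0" "imbalance v a e C = 0"
    using step sub mem_indep_model_iff[of a e C "N - {x}"] by blast+
  then show ?case
    using upper_modular_imbalance_step[OF v x step.hyps] by simp
qed

lemma upper_modular_indep_model_subset_iff:
  assumes fin: "finite N" and x: "x \<in> N" and u: "upper_modular N x u" "u \<in> supermodular_cone N"
    and v: "upper_modular N x v"
  shows "indep_model N u \<subseteq> indep_model N v \<longleftrightarrow>
    indep_model (N - {x}) u \<subseteq> indep_model (N - {x}) v"
proof
  assume "indep_model N u \<subseteq> indep_model N v"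
  then show "indep_model (N - {x}) u \<subseteq> indep_model (N - {x}) v"
    using triplets_mono[of "N - {x}" N] unfolding indep_model_def by blast
next
  assume sub: "indep_model (N - {x}) u \<subseteq> indep_model (N - {x}) v"
  note transfer = upper_modular_indep_transfer[OF fin x _ _ u v sub]
  have "imbalance v a b C = 0"
    if t: "(a, b, C) \<in> triplets N" and 0: "imbalance u a b C = 0" for a b C
    using t
  proof (cases rule: triplets_cases[where x = x])
    case cond
    then show ?thesis using v t unfolding upper_modular_def by fastforce
  next
    case fst
    then show ?thesis using transfer 0 by simp
  next
    case snd
    then show ?thesis using transfer 0 imbalance_commute[of _ a b C] by simp
  next
    case del
    then show ?thesis using sub 0 mem_indep_model_iff[of a b C "N - {x}"] by blast
  qed
  then show "indep_model N u \<subseteq> indep_model N v"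
    by (auto simp: mem_indep_model_iff)
qed

text \<open>The preceding comparison with the zero function in the role of \<open>u\<close>, since
  its model consists of all triplets.\<close>

lemma upper_modular_modular_iff:
  assumes fin: "finite N" and x: "x \<in> N" and u: "upper_modular N x u"
  shows "triplets N \<subseteq> indep_model N u \<longleftrightarrow>
    triplets (N - {x}) \<subseteq> indep_model (N - {x}) u"
proof -
  let ?z = "\<lambda>A\<in>Pow N. 0 :: real"
  \<comment> \<open>The zero functions on the two power sets differ as extensional functions, so
    their models over \<open>N - {x}\<close> have to be identified.\<close>
  have "indep_model (N - {x}) ?z = indep_model (N - {x}) (\<lambda>A\<in>Pow (N - {x}). 0)"
    by (rule indep_model_cong) auto
  moreover have "upper_modular N x ?z"
    using x zero_function(2)[OF fin]
    by (auto simp: upper_modular_def imbalance_def triplets_def)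
  ultimately show ?thesis
    using upper_modular_indep_model_subset_iff[OF fin x _ zero_function(1)[OF fin] u]
      zero_function(2)[OF fin] zero_function(2)[of "N - {x}"] fin by simp
qed

section \<open>The upper modular extension\<close>

lemma upper_mod_ext_mem_setfuns: "upper_mod_ext N M r \<in> setfuns N"
  by (auto simp: upper_mod_ext_def setfuns_def)

lemma upper_mod_ext_eq: "M \<subseteq> N \<Longrightarrow> A \<subseteq> M \<Longrightarrow> upper_mod_ext N M r A = r A"
  by (auto simp: upper_mod_ext_def)

lemma upper_mod_ext_insert:
  assumes "x \<in> N" "A \<subseteq> N - {x}"
  shows "upper_mod_ext N (N - {x}) r (insert x A) = r A - upper_std (N - {x}) r A"
proof -
  have "insert x A \<inter> (N - {x}) = A" "insert x A \<subseteq> N" "\<not> insert x A \<subseteq> N - {x}"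
    using assms by auto
  then show ?thesis
    by (simp add: upper_mod_ext_def)
qed

text \<open>\<open>upper_std M r\<close> differs from \<open>r\<close> by a modular function, so
  inserting \<open>a\<close> changes the difference by an amount independent of
  \<open>C\<close>.\<close>

lemma upper_std_insert:
  assumes "finite M" "a \<in> M" "C \<subseteq> M - {a}"
  shows "upper_std M r (insert a C) - r (insert a C) = upper_std M r C - r C + r (M - {a}) - r M"
proof -
  have "finite C" "a \<notin> C" "C \<subseteq> M"
    using assms finite_subset[of C M] by auto
  then show ?thesis
    using assms(2) by (simp add: upper_std_def)
qed

lemma imbalance_upper_mod_ext:
  assumes "x \<in> N" "a \<in> N - {x}" "C \<subseteq> N - {x} - {a}"
  shows "imbalance (upper_mod_ext N (N - {x}) r) x a C =
    upper_std (N - {x}) r C - upper_std (N - {x}) r (insert a C)"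
proof -
  have "C \<subseteq> N - {x}" "insert a C \<subseteq> N - {x}"
    using assms by auto
  then show ?thesis
    using assms(1) by (simp add: imbalance_def upper_mod_ext_insert upper_mod_ext_eq)
qed

text \<open>On sets containing \<open>x\<close> the extension is \<open>r\<close> minus its upper
  standardization, which is modular. At the largest conditioning set the imbalance vanishes because
  the standardization takes equal values at \<open>M - {a}\<close> and \<open>M\<close>, where
  \<open>M = N - {x}\<close>.\<close>

lemma upper_modular_upper_mod_ext:
  assumes fin: "finite N" and x: "x \<in> N"
  shows "upper_modular N x (upper_mod_ext N (N - {x}) r)"
proof -
  let ?M = "N - {x}" and ?m = "upper_mod_ext N (N - {x}) r"
  have "imbalance ?m a b C = 0" if t: "(a, b, C) \<in> triplets N" "x \<in> C" for a b C
  proof -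
    define D where "D = C - {x}"
    have D: "C = insert x D" "a \<in> ?M" "b \<in> ?M" "a \<noteq> b" "D \<subseteq> ?M - {a, b}"
      using t by (auto simp: mem_triplets_iff D_def)
    have "?m (insert x E) = r E - upper_std ?M r E" if "E \<subseteq> ?M" for E
      using upper_mod_ext_insert[OF x that] .
    moreover have "D \<subseteq> ?M" "insert a D \<subseteq> ?M" "insert b D \<subseteq> ?M" "insert a (insert b D) \<subseteq> ?M"
      using D by auto
    ultimately have "imbalance ?m a b C =
        (r (insert a (insert b D)) - upper_std ?M r (insert a (insert b D)))
        + (r D - upper_std ?M r D) - (r (insert a D) - upper_std ?M r (insert a D))
        - (r (insert b D) - upper_std ?M r (insert b D))"
      unfolding imbalance_def D(1) insert_commute[of _ x] by simp
    moreover have "a \<in> ?M" "insert b D \<subseteq> ?M - {a}" "D \<subseteq> ?M - {a}"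
      using D by auto
    ultimately show ?thesis
      using upper_std_insert[of ?M a "insert b D" r] upper_std_insert[of ?M a D r] fin by simp
  qed
  moreover have "imbalance ?m x a (?M - {a}) = 0" if "a \<in> ?M" for a
    using imbalance_upper_mod_ext[OF x that, of "?M - {a}" r] upper_std_insert[of ?M a "?M - {a}" r]
      fin that by (simp add: insert_absorb)
  ultimately show ?thesis
    unfolding upper_modular_def by blast
qed

section \<open>Transfer of supermodularity, independence and extremality\<close>

lemma upper_mod_ext_supermodular_iff:
  assumes "finite N" "x \<in> N" "r \<in> setfuns (N - {x})"
  shows "upper_mod_ext N (N - {x}) r \<in> supermodular_cone N \<longleftrightarrow>
    r \<in> supermodular_cone (N - {x})"
  using assms upper_modular_upper_mod_ext upper_mod_ext_mem_setfuns
  by (intro upper_modular_supermodular_iff) (auto simp: upper_mod_ext_eq)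

lemma cond_indep_upper_mod_ext_iff:
  assumes fin: "finite N" and x: "x \<in> N" and t: "(a, b, C) \<in> triplets N"
  shows "cond_indep (upper_mod_ext N (N - {x}) r) a b C \<longleftrightarrow>
    x \<in> C \<or>
    (x \<in> {a, b} \<and>
      upper_std (N - {x}) r (({a} \<union> {b} \<union> C) - {x}) = upper_std (N - {x}) r C) \<or>
    (x \<notin> {a} \<union> {b} \<union> C \<and> cond_indep r a b C)"
  using t
proof (cases rule: triplets_cases[where x = x])
  case cond
  then show ?thesis
    using upper_modular_upper_mod_ext[OF fin x, of r] t
    unfolding upper_modular_def cond_indep_iff by fastforce
next
  case fst
  then have sets: "({a} \<union> {b} \<union> C) - {x} = insert b C" "x \<notin> C" "x \<in> {a, b}"
    "x \<in> {a} \<union> {b} \<union> C"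
    by auto
  have "cond_indep (upper_mod_ext N (N - {x}) r) a b C \<longleftrightarrow>
      upper_std (N - {x}) r (insert b C) = upper_std (N - {x}) r C"
    unfolding cond_indep_iff fst(1) imbalance_upper_mod_ext[OF x fst(2,3)] by auto
  then show ?thesis
    unfolding sets(1) using sets(2-4) by blast
next
  case snd
  then have sets: "({a} \<union> {b} \<union> C) - {x} = insert a C" "x \<notin> C" "x \<in> {a, b}"
    "x \<in> {a} \<union> {b} \<union> C"
    by auto
  have "cond_indep (upper_mod_ext N (N - {x}) r) a b C \<longleftrightarrow>
      upper_std (N - {x}) r (insert a C) = upper_std (N - {x}) r C"
    unfolding cond_indep_iff snd(1) imbalance_commute[of _ a x]
      imbalance_upper_mod_ext[OF x snd(2,3)] by auto
  then show ?thesis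
    unfolding sets(1) using sets(2-4) by blast
next
  case del
  then show ?thesis
    using imbalance_cong[of "N - {x}" "upper_mod_ext N (N - {x}) r" r, OF _ del(2)]
    by (auto simp: cond_indep_iff upper_mod_ext_eq)
qed

text \<open>Competitors are carried across in both directions, by restriction from \<open>N\<close>
  to \<open>N - {x}\<close> and by extension back; inclusions between models and non-modularity are
  preserved each way.\<close>

lemma extreme_upper_mod_ext_iff:
  assumes fin: "finite N" and x: "x \<in> N" and r: "r \<in> setfuns (N - {x})"
  shows "extreme_supermodular (N - {x}) r \<longleftrightarrow>
    extreme_supermodular N (upper_mod_ext N (N - {x}) r)"
proof -
  let ?M = "N - {x}" and ?T = "upper_mod_ext N (N - {x})"
  have finM: "finite ?M" using fin by simp
  have um: "upper_modular N x (?T s)" for s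
    by (rule upper_modular_upper_mod_ext[OF fin x])
  have restr: "indep_model ?M (?T s) = indep_model ?M s" for s
    by (rule indep_model_cong) (auto simp: upper_mod_ext_eq)
  have cone: "?T s \<in> supermodular_cone N \<longleftrightarrow> s \<in> supermodular_cone ?M" if "s \<in> setfuns ?M" for s
    by (rule upper_mod_ext_supermodular_iff[OF fin x that])
  have modular: "triplets N \<subseteq> indep_model N (?T s) \<longleftrightarrow> triplets ?M \<subseteq> indep_model ?M s" for s
    using upper_modular_modular_iff[OF fin x um] restr by simp
  show ?thesis
  proof (cases "r \<in> supermodular_cone ?M")
    case r_in: True
    then have Tr: "?T r \<in> supermodular_cone N" using cone[OF r] by simp
    let ?extremal = "\<lambda>L m. \<forall>u \<in> supermodular_cone L. indep_model L m \<subseteq> indep_model L u \<longrightarrow>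
        \<not> triplets L \<subseteq> indep_model L u \<longrightarrow> indep_model L u \<subseteq> indep_model L m"
    have "?extremal ?M r \<longleftrightarrow> ?extremal N (?T r)"
    proof (intro iffI ballI impI)
      fix u assume H: "?extremal ?M r" and u: "u \<in> supermodular_cone N"
        and sub: "indep_model N (?T r) \<subseteq> indep_model N u" and nm: "\<not> triplets N \<subseteq> indep_model N u"
      \<comment> \<open>The larger model of \<open>u\<close> is what makes its restriction carry all
        the information needed.\<close>
      have uu: "upper_modular N x u"
        by (rule upper_modular_mono[OF um sub x])
      define s where "s = restrict u (Pow ?M)"
      have s_eq: "s A = u A" if "A \<subseteq> ?M" for A
        using that by (simp add: s_def)
      have s: "indep_model ?M s = indep_model ?M u"
        by (rule indep_model_cong[OF s_eq])
      have "u \<in> setfuns N" using u by (simp add: supermodular_cone_def)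
      moreover have "s \<in> setfuns ?M" by (simp add: s_def setfuns_def)
      ultimately have "s \<in> supermodular_cone ?M"
        using upper_modular_supermodular_iff[OF fin x uu] s_eq u by blast
      moreover have "indep_model ?M r \<subseteq> indep_model ?M s"
        using sub upper_modular_indep_model_subset_iff[OF fin x um Tr uu] restr s by simp
      moreover have "\<not> triplets ?M \<subseteq> indep_model ?M s"
        using nm upper_modular_modular_iff[OF fin x uu] s by simp
      ultimately have "indep_model ?M s \<subseteq> indep_model ?M r"
        using H by blast
      then show "indep_model N u \<subseteq> indep_model N (?T r)"
        using upper_modular_indep_model_subset_iff[OF fin x uu u um] restr s by simp
    next
      fix s assume H: "?extremal N (?T r)" and s: "s \<in> supermodular_cone ?M"
        and sub: "indep_model ?M r \<subseteq> indep_model ?M s" and nm: "\<not> triplets ?M \<subseteq> indep_model ?M s"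
      have Ts: "?T s \<in> supermodular_cone N"
        using cone s by (simp add: supermodular_cone_def)
      moreover have "indep_model N (?T r) \<subseteq> indep_model N (?T s)"
        using sub upper_modular_indep_model_subset_iff[OF fin x um Tr um] restr by simp
      ultimately have "indep_model N (?T s) \<subseteq> indep_model N (?T r)"
        using H modular nm by blast
      then show "indep_model ?M s \<subseteq> indep_model ?M r"
        using upper_modular_indep_model_subset_iff[OF fin x um Ts um] restr by simp
    qed
    then show ?thesis
      unfolding extreme_supermodular_iff[OF fin] extreme_supermodular_iff[OF finM]
      using r_in Tr modular[of r] by simp
  next
    case False
    then show ?thesis using cone[OF r] by (simp add: extreme_supermodular_def)
  qed
qed

theorem mainTheorem8:
  fixes N M :: "'a set" and x :: 'a and r m :: "'a set \<Rightarrow> real"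
  assumes "finite N" and "card N \<ge> 2" and "x \<in> N"
    and "M = N - {x}"
    and "r \<in> setfuns M"
    and "m = upper_mod_ext N M r"
  shows "(m \<in> supermodular_cone N \<longleftrightarrow> r \<in> supermodular_cone M) \<and>
    (\<forall>(a, b, C) \<in> triplets N.
       cond_indep m a b C \<longleftrightarrow>
         x \<in> C \<or>
         (x \<in> {a, b} \<and> upper_std M r (({a} \<union> {b} \<union> C) - {x}) = upper_std M r C) \<or>
         (x \<notin> {a} \<union> {b} \<union> C \<and> cond_indep r a b C)) \<and>
    (extreme_supermodular M r \<longleftrightarrow> extreme_supermodular N m)"
proof -
  have "cond_indep m a b C \<longleftrightarrow>
         x \<in> C \<or>
         (x \<in> {a, b} \<and> upper_std M r (({a} \<union> {b} \<union> C) - {x}) = upper_std M r C) \<or>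
         (x \<notin> {a} \<union> {b} \<union> C \<and> cond_indep r a b C)" if "(a, b, C) \<in> triplets N" for a b C
    using cond_indep_upper_mod_ext_iff[OF assms(1,3) that] unfolding assms(4,6) .
  then show ?thesis
    using upper_mod_ext_supermodular_iff[OF assms(1,3)] extreme_upper_mod_ext_iff[OF assms(1,3)]
      assms(4-6) by blast
qed

end
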